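(* Let $\mu,\kappa,\theta,\xi,\rho$ be real model parameters (with $|\rho|\le1$), and consider the Heston model $$dX_1(t,x)=\mu X_1(t,x)\,dt+\sqrt{X_2(t,x)_+}\,X_1(t,x)\,dB^1(t),$$ $$dX_2(t,x)=\kappa\big(\theta-X_2(t,x)_+\big)\,dt+\xi\sqrt{X_2(t,x)_+}\,\big(\rho\,dB^1(t)+\sqrt{1-\rho^2}\,dB^2(t)\big),$$ where $x_+=x\vee0$. Let $\{M_n;\,n\ge0\}$ and $\{L_n;\,n\ge0\}$ be the vector fields on $\mathbf{R}^2$ defined by $$M_n=2x_1\,(x_2)_+^{-\frac n2+1}\frac{\partial}{\partial x_1},\qquad L_n=2\,(x_2)_+^{-\frac n2+1}\frac{\partial}{\partial x_2},$$ and put $W_{2n}=L_n$, $W_{2n+1}=M_n$ for $n\ge0$. Then: (1) For all $n,m\ge0$: $[M_n,M_m]=0$, $[M_n,L_m]=(n-2)M_{n+m}$, $[L_n,L_m]=(n-m)L_{n+m}$. Consequently $[W_n,W_m]=c_{nm}W_{n+m}$, where $c_{nm}=0$ if $n,m$ are both odd, $c_{nm}=\frac{n-5}{2}$ if $n$ is odd and $m$ is even, and $c_{nm}=\frac{n-m}{2}$ if $n,m$ are both even (and $c_{nm}=-c_{mn}$ if $n$ is even and $m$ is odd). (2) The vector fields of the Heston model are given by $$V_0=\tfrac12\Big(\mu-\frac{\xi\rho}{4}\Big)W_5-\tfrac14W_1+\tfrac12\Big(\kappa\theta-\frac{\xi^2}{4}\Big)W_4-\frac{\kappa}{2}W_0,\qquad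 V_1=\tfrac12W_3+\frac{\xi\rho}{2}W_2,\qquad V_2=\frac{\xi\sqrt{1-\rho^2}}{2}W_2.$$ Therefore the Heston model satisfies the Witt condition. (3) The flows of $M_n$ and $L_n$ have the explicit expressions $$\exp(tM_n)(x)=\Big(x_1\exp\big(2\,(x_2)_+^{-\frac n2+1}\,t\big),\;x_2\Big)\quad(n\ge0),\qquad \exp(tL_n)(x)=\Big(x_1,\;\big(nt+(x_2)_+^{\frac n2}\big)_+^{\frac2n}\Big)\quad(n\ge1).$$
   Context: $B^1,B^2$ are independent Brownian motions and the SDE is in Itô form. For an Itô SDE $dX=b(X)\,dt+\sum_{i=1}^d\sigma_i(X)\,dB^i$, its (Stratonovich) vector fields are $V_i=\sigma_i$ ($1\le i\le d$) and $V_0^k=b^k-\frac12\sum_{i=1}^d\sum_{j}\sigma_i^j\,\partial_j\sigma_i^k$, identified with the first-order differential operators $\sum_kV_i^k\,\partial/\partial x_k$; $[V,V']=VV'-V'V$. $\exp(tW)(x)$ denotes the flow of $tW$ at time one started at $x$, i.e. the value at time $t$ of the solution $u$ of $\dot u=W(u)$, $u(0)=x$. The vector fields and their flows are extended to all of $\mathbf{R}^2$ by means of the positive parts, because flows at negative times are needed in applications; the vector fields and flows are not smooth at critical points, and the vector fields are not in $C_b^\infty(\mathbf{R}^2;\mathbf{R}^2)$ (smooth with bounded derivatives of any order). Witt condition: a family $\{V_0,\dots,V_d\}$ satisfies the Witt condition if there is a set of vector fields $\{W_n;n\ge0\}$ with $V_i\in\mathrm{span}\{W_n;n\ge0\}$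 for $i=0,\dots,d$ and, for any $n,m\ge0$, $[W_n,W_m]=\alpha_{nm}W_{n+m}$ with $\alpha_{nm}\in\mathbf{R}$.
   Formalization: Brackets are stated off x₂=0; the V₀ formula and Witt condition for x₂>0. exp(tL_n) is the flow for x₂>0 (or x₂=0, t≤0); elsewhere the formula is a solution from (x₁,(x₂)₊) and a limit of flows. Solutions may fail the ODE at finitely many times. *)

theory Defs
  imports "HOL-Analysis.Analysis"
begin

definition pos_part :: "real \<Rightarrow> real" where
  "pos_part a = max a 0"

section \<open>Vector fields as differential operators\<close>

definition partial :: "'n::finite \<Rightarrow> (real ^ 'n \<Rightarrow> 'b::real_normed_vector) \<Rightarrow> real ^ 'n \<Rightarrow> 'b" where
  "partial i f x = vector_derivative (\<lambda>h. f (x + h *\<^sub>R axis i 1)) (at 0)"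

text \<open>Infinite differentiability on \<open>U\<close>, used for open \<open>U\<close> only: all iterated partial
  derivatives are differentiable on \<open>U\<close>, hence also continuous there.\<close>

coinductive smooth_on :: "(real ^ 'n) set \<Rightarrow> (real ^ 'n::finite \<Rightarrow> 'b::real_normed_vector) \<Rightarrow> bool"
  for U where
  "\<lbrakk>\<forall>x\<in>U. f differentiable (at x); \<forall>i. smooth_on U (partial i f)\<rbrakk> \<Longrightarrow> smooth_on U f"

definition vf_op :: "(real ^ 'n \<Rightarrow> real ^ 'n) \<Rightarrow> (real ^ 'n::finite \<Rightarrow> real) \<Rightarrow> real ^ 'n \<Rightarrow> real" where
  "vf_op V f x = (\<Sum>k\<in>UNIV. V x $ k * partial k f x)"

definition commutator ::
    "(real ^ 'n \<Rightarrow> real ^ 'n) \<Rightarrow> (real ^ 'n \<Rightarrow> real ^ 'n) \<Rightarrow>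
     (real ^ 'n::finite \<Rightarrow> real) \<Rightarrow> real ^ 'n \<Rightarrow> real" where
  "commutator V V' f x = vf_op V (vf_op V' f) x - vf_op V' (vf_op V f) x"

text \<open>\<open>bracket_on U V V' Z\<close> says \<open>[V, V'] = Z\<close> on \<open>U\<close>. The set \<open>U\<close> has to be explicit,
  since the fields considered below are not differentiable on all of the plane.\<close>

definition bracket_on ::
    "(real ^ 'n) set \<Rightarrow> (real ^ 'n \<Rightarrow> real ^ 'n) \<Rightarrow> (real ^ 'n \<Rightarrow> real ^ 'n) \<Rightarrow>
     (real ^ 'n::finite \<Rightarrow> real ^ 'n) \<Rightarrow> bool" where
  "bracket_on U V V' Z \<longleftrightarrow>
     (\<forall>f. smooth_on U f \<longrightarrow> (\<forall>x\<in>U. commutator V V' f x = vf_op Z f x))"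

definition witt_condition_on ::
    "(real ^ 'n) set \<Rightarrow> nat \<Rightarrow> (nat \<Rightarrow> real ^ 'n \<Rightarrow> real ^ 'n::finite) \<Rightarrow> bool" where
  "witt_condition_on U d V \<longleftrightarrow>
     (\<exists>(W :: nat \<Rightarrow> real ^ 'n \<Rightarrow> real ^ 'n) (\<alpha> :: nat \<Rightarrow> nat \<Rightarrow> real).
        (\<forall>n. smooth_on U (W n)) \<and>
        (\<forall>i\<le>d. \<exists>S c. finite S \<and> (\<forall>x\<in>U. V i x = (\<Sum>n\<in>S. c n *\<^sub>R W n x))) \<and>
        (\<forall>n m. bracket_on U (W n) (W m) (\<lambda>x. \<alpha> n m *\<^sub>R W (n + m) x)))"

section \<open>Vector fields of an Ito equation\<close>

text \<open>An equation with drift \<open>b\<close> and diffusion coefficients \<open>\<sigma> 1, \<dots>, \<sigma> d\<close> is represented by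
  these coefficients.\<close>

definition sde_field ::
    "(real ^ 'n \<Rightarrow> real ^ 'n) \<Rightarrow> (nat \<Rightarrow> real ^ 'n \<Rightarrow> real ^ 'n) \<Rightarrow> nat \<Rightarrow>
     nat \<Rightarrow> real ^ 'n \<Rightarrow> real ^ 'n::finite" where
  "sde_field b \<sigma> d i x =
     (if i = 0 then
        (\<chi> k. b x $ k - 1 / 2 * (\<Sum>l=1..d. \<Sum>j\<in>UNIV. \<sigma> l x $ j * partial j (\<lambda>y. \<sigma> l y $ k) x))
      else \<sigma> i x)"

section \<open>Flows\<close>

definition ode_solution ::
    "('a::real_normed_vector \<Rightarrow> 'a) \<Rightarrow> real set \<Rightarrow> (real \<Rightarrow> 'a) \<Rightarrow> bool" where
  "ode_solution W T u \<longleftrightarrow> (\<forall>s\<in>T. (u has_vector_derivative W (u s)) (at s within T))"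

text \<open>Continuous solutions for which the equation may fail at finitely many times. This is needed
  for trajectories that reach a critical point, where the field is discontinuous.\<close>

definition pw_ode_solution ::
    "('a::real_normed_vector \<Rightarrow> 'a) \<Rightarrow> real set \<Rightarrow> (real \<Rightarrow> 'a) \<Rightarrow> bool" where
  "pw_ode_solution W T u \<longleftrightarrow> continuous_on T u \<and>
     (\<exists>F. finite F \<and> (\<forall>s\<in>T - F. (u has_vector_derivative W (u s)) (at s within T)))"

definition flow :: "('a::real_normed_vector \<Rightarrow> 'a) \<Rightarrow> real \<Rightarrow> 'a \<Rightarrow> 'a" where
  "flow W t x = (THE y. \<exists>u. pw_ode_solution W (closed_segment 0 t) u \<and> u 0 = x \<and> u t = y)"

section \<open>The Heston model\<close>

definition heston_drift :: "real \<Rightarrow> real \<Rightarrow> real \<Rightarrow> real ^ 2 \<Rightarrow> real ^ 2" where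
  "heston_drift \<mu> \<kappa> \<theta> x = vector [\<mu> * x $ 1, \<kappa> * (\<theta> - pos_part (x $ 2))]"

definition heston_diffusion :: "real \<Rightarrow> real \<Rightarrow> nat \<Rightarrow> real ^ 2 \<Rightarrow> real ^ 2" where
  "heston_diffusion \<xi> \<rho> i x =
     (if i = 1 then vector [sqrt (pos_part (x $ 2)) * x $ 1, \<xi> * sqrt (pos_part (x $ 2)) * \<rho>]
      else if i = 2 then vector [0, \<xi> * sqrt (pos_part (x $ 2)) * sqrt (1 - \<rho>\<^sup>2)]
      else 0)"

definition heston_field ::
    "real \<Rightarrow> real \<Rightarrow> real \<Rightarrow> real \<Rightarrow> real \<Rightarrow> nat \<Rightarrow> real ^ 2 \<Rightarrow> real ^ 2" where
  "heston_field \<mu> \<kappa> \<theta> \<xi> \<rho> = sde_field (heston_drift \<mu> \<kappa> \<theta>) (heston_diffusion \<xi> \<rho>) 2"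

text \<open>Since \<open>0 powr a = 0\<close> for every \<open>a\<close>, including \<open>a \<le> 0\<close>, the following fields vanish on
  the closed lower half plane. For \<open>n \<ge> 2\<close> this fixes the meaning of \<open>(x\<^sub>2)\<^sub>+\<close> to the power
  \<open>1 - n / 2\<close> there.\<close>

definition heston_M :: "nat \<Rightarrow> real ^ 2 \<Rightarrow> real ^ 2" where
  "heston_M n x = vector [2 * x $ 1 * pos_part (x $ 2) powr (- (real n / 2) + 1), 0]"

definition heston_L :: "nat \<Rightarrow> real ^ 2 \<Rightarrow> real ^ 2" where
  "heston_L n x = vector [0, 2 * pos_part (x $ 2) powr (- (real n / 2) + 1)]"

definition heston_W :: "nat \<Rightarrow> real ^ 2 \<Rightarrow> real ^ 2" where
  "heston_W k = (if even k then heston_L (k div 2) else heston_M (k div 2))"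

definition heston_c :: "nat \<Rightarrow> nat \<Rightarrow> real" where
  "heston_c n m =
     (if odd n \<and> odd m then 0
      else if odd n \<and> even m then (real n - 5) / 2
      else if even n \<and> even m then (real n - real m) / 2
      else - ((real m - 5) / 2))"

definition heston_M_flow :: "nat \<Rightarrow> real \<Rightarrow> real ^ 2 \<Rightarrow> real ^ 2" where
  "heston_M_flow n t x =
     vector [x $ 1 * exp (2 * pos_part (x $ 2) powr (- (real n / 2) + 1) * t), x $ 2]"

text \<open>The value at \<open>t = 0\<close> is \<open>(x\<^sub>1, (x\<^sub>2)\<^sub>+)\<close>, which differs from \<open>x\<close> if \<open>x\<^sub>2 < 0\<close>: the
  positive part extends the flow of the upper half plane.\<close>

definition heston_L_flow :: "nat \<Rightarrow> real \<Rightarrow> real ^ 2 \<Rightarrow> real ^ 2" where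
  "heston_L_flow n t x =
     vector [x $ 1, pos_part (real n * t + pos_part (x $ 2) powr (real n / 2)) powr (2 / real n)]"

end

(*
For smooth f the second-order parts of V (V' f) and V' (V f) agree by Clairaut's theorem, so a
bracket is determined by the first partial derivatives of the components. On the upper half plane
these components are monomials x2^a (x1 u + w), a class closed under partial derivatives.

The flow of L reduces to the scalar equation y' = 2 (y_+)^(1 - n/2), which y^(n/2) linearises as
long as y > 0. Solutions are nondecreasing, so going forward a positive one stays positive; going
backward one can only reach 0, where it stays, at the time where n t + y(0)^(n/2) vanishes.
*)

theory Submission
  imports Defs
begin

section \<open>Partial derivatives\<close>

text \<open>The obstacle is the axis x2 = 0. The fields are not differentiable there, and L_n is
  even discontinuous for n >= 2, so brackets are taken off the axis. Below the axis all M_n and L_n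
  vanish while the drift of the model need not, so V_0 is a combination of the W_n only above it.
  For L_n with n >= 1 the axis also destroys uniqueness: from x2 = 0, forward in time, both the
  constant trajectory and x2 = (n t)^(2/n) are solutions. From x2 < 0 the only solution is constant,
  whereas the closed formula is nonnegative. The formula is therefore the flow itself for x2 > 0,
  and for x2 = 0 with t <= 0; for every other x it is recovered as the limit of flows started
  slightly above the positive part of x2. Finitely many exceptional times are allowed because for n
  >= 2 the formula has a corner or an infinite slope when it leaves zero.\<close>

lemma partial_eq:
  assumes "((\<lambda>h. f (x + h *\<^sub>R axis i 1)) has_vector_derivative D) (at 0)"
  shows "partial i f x = D"
  unfolding partial_def using assms by (rule vector_derivative_at)

lemma has_vector_derivative_line:
  assumes "(f has_derivative f') (at (x + s *\<^sub>R v))"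
  shows "((\<lambda>h. f (x + h *\<^sub>R v)) has_vector_derivative f' v) (at s)"
proof -
  have "((\<lambda>h. x + h *\<^sub>R v) has_vector_derivative v) (at s)"
    by (auto intro!: derivative_eq_intros)
  from vector_derivative_diff_chain_within[OF this, of f f'] assms
  show ?thesis by (simp add: o_def has_derivative_at_withinI)
qed

lemma partial_has_derivative:
  assumes "(f has_derivative f') (at x)"
  shows "partial i f x = f' (axis i 1)"
  by (rule partial_eq, rule has_vector_derivative_line) (use assms in simp)

text \<open>Gives the derivative at every parameter \<open>s\<close> of the line, not only at 0,
  which is the form the mean value theorem needs.\<close>

lemma has_real_derivative_line:
  fixes f :: "real ^ 'n::finite \<Rightarrow> real"
  assumes "f differentiable (at (x + s *\<^sub>R axis i 1))"
  shows "((\<lambda>h. f (x + h *\<^sub>R axis i 1)) has_real_derivative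
    partial i f (x + s *\<^sub>R axis i 1)) (at s)"
proof -
  from assms obtain f' where f': "(f has_derivative f') (at (x + s *\<^sub>R axis i 1))"
    by (auto simp: differentiable_def)
  from has_vector_derivative_line[OF this] show ?thesis
    by (simp add: partial_has_derivative[OF f'] has_real_derivative_iff_has_vector_derivative)
qed

lemma partial_mult:
  fixes f g :: "real ^ 'n::finite \<Rightarrow> real"
  assumes "f differentiable (at x)" "g differentiable (at x)"
  shows "partial i (\<lambda>y. f y * g y) x = f x * partial i g x + partial i f x * g x"
proof -
  from assms obtain f' g' where f': "(f has_derivative f') (at x)" "(g has_derivative g') (at x)"
    by (auto simp: differentiable_def)
  show ?thesis
    using partial_has_derivative[OF has_derivative_mult[OF f']]
    by (simp add: partial_has_derivative[OF f'(1)] partial_has_derivative[OF f'(2)])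
qed

lemma partial_sum:
  fixes f :: "'k \<Rightarrow> real ^ 'n::finite \<Rightarrow> real"
  assumes "\<And>k. k \<in> K \<Longrightarrow> f k differentiable (at x)"
  shows "partial i (\<lambda>y. \<Sum>k\<in>K. f k y) x = (\<Sum>k\<in>K. partial i (f k) x)"
proof -
  from assms obtain f' where f': "\<And>k. k \<in> K \<Longrightarrow> (f k has_derivative f' k) (at x)"
    unfolding differentiable_def by metis
  show ?thesis
    using partial_has_derivative[OF has_derivative_sum[of K f f', OF f']]
    by (simp add: partial_has_derivative[OF f'])
qed

section \<open>Smooth functions, Clairaut's theorem and the first-order form of commutators\<close>

lemma smooth_onD:
  assumes "smooth_on U f"
  shows "x \<in> U \<Longrightarrow> f differentiable (at x)" and "smooth_on U (partial i f)"
  using assms by (auto elim: smooth_on.cases)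

text \<open>The mean value theorem is applied twice: in the first variable to the difference
  \<open>F s h - F s 0\<close>, then in the second to \<open>F1 a\<close>.\<close>

lemma mixed_second_difference:
  fixes F :: "real \<Rightarrow> real \<Rightarrow> real"
  assumes h: "0 < h"
    and F1: "\<And>s t. \<lbrakk>0 \<le> s; s \<le> h; 0 \<le> t; t \<le> h\<rbrakk> \<Longrightarrow> ((\<lambda>s. F s t) has_real_derivative F1 s t) (at s)"
    and F12: "\<And>s t. \<lbrakk>0 \<le> s; s \<le> h; 0 \<le> t; t \<le> h\<rbrakk> \<Longrightarrow> ((\<lambda>t. F1 s t) has_real_derivative F12 s t) (at t)"
  shows "\<exists>a b. 0 < a \<and> a < h \<and> 0 < b \<and> b < h \<and> F h h - F h 0 - F 0 h + F 0 0 = h * h * F12 a b"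
proof -
  have "\<exists>z. 0 < z \<and> z < h \<and> (F h h - F h 0) - (F 0 h - F 0 0) = (h - 0) * (F1 z h - F1 z 0)"
    by (rule MVT2[of 0 h "\<lambda>s. F s h - F s 0"]) (use h in \<open>auto intro!: derivative_intros F1\<close>)
  then obtain a where a: "0 < a" "a < h"
    "(F h h - F h 0) - (F 0 h - F 0 0) = h * (F1 a h - F1 a 0)" by auto
  have "\<exists>z. 0 < z \<and> z < h \<and> F1 a h - F1 a 0 = (h - 0) * F12 a z"
    by (rule MVT2) (use h a in \<open>auto intro!: F12\<close>)
  then obtain b where b: "0 < b" "b < h" "F1 a h - F1 a 0 = h * F12 a b" by auto
  have "F h h - F h 0 - F 0 h + F 0 0 = h * h * F12 a b"
    using a(3) unfolding b(3) by simp
  with a b show ?thesis by blast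
qed

text \<open>The second difference over a small square does not depend on the order of the two
  directions, so each mixed derivative takes the same value at some point near \<open>x\<close>;
  continuity transfers this to \<open>x\<close>.\<close>

lemma partial_commute:
  fixes f :: "real ^ 'n::finite \<Rightarrow> real"
  assumes U: "open U" "x \<in> U" and f: "smooth_on U f"
  shows "partial i (partial j f) x = partial j (partial i f) x"
proof (rule ccontr)
  assume ne: "partial i (partial j f) x \<noteq> partial j (partial i f) x"
  \<comment> \<open>Half the gap: one common value cannot be closer than \<open>e\<close> to both
    mixed derivatives.\<close>
  define e where "e = dist (partial i (partial j f) x) (partial j (partial i f) x) / 2"
  have e: "e > 0" using ne by (simp add: e_def)
  have cont: "isCont (partial k (partial l f)) x" for k l
    by (meson U f smooth_onD differentiable_imp_continuous_within)
  have "\<exists>d>0. \<forall>y. dist y x < d \<longrightarrow> dist (partial k (partial l f) y) (partial k (partial l f) x) < e" for k l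
    using cont[of k l] e unfolding continuous_at_eps_delta by auto
  then obtain d where d: "\<And>k l. d k l > 0"
    "\<And>k l y. dist y x < d k l \<Longrightarrow> dist (partial k (partial l f) y) (partial k (partial l f) x) < e"
    by metis
  obtain r where r: "r > 0" "ball x r \<subseteq> U" using U openE by metis
  \<comment> \<open>Points of the square are displaced by at most 2 h, so the factor 3 leaves the
    strict inequalities that the balls require.\<close>
  define h where "h = min r (min (d i j) (d j i)) / 3"
  have h: "h > 0" "3 * h \<le> r" "3 * h \<le> d i j" "3 * h \<le> d j i"
    using r d by (auto simp: h_def)
  have near: "dist (x + s *\<^sub>R axis k 1 + t *\<^sub>R axis l 1) x < 3 * h"
    if "0 \<le> s" "s \<le> h" "0 \<le> t" "t \<le> h" for s t and k l :: 'n
  proof -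
    have "norm (s *\<^sub>R axis k (1::real) + t *\<^sub>R axis l 1) \<le> s + t"
      using norm_triangle_ineq[of "s *\<^sub>R axis k (1::real)" "t *\<^sub>R axis l 1"] that by simp
    with that h show ?thesis by (simp add: dist_norm add.assoc)
  qed
  have diff: "g differentiable (at (x + s *\<^sub>R axis k 1 + t *\<^sub>R axis l 1))"
    if "0 \<le> s" "s \<le> h" "0 \<le> t" "t \<le> h" "smooth_on U g" for s t and k l :: 'n and g :: "real ^ 'n \<Rightarrow> real"
    using near[of s t k l] that h r by (intro smooth_onD(1)[OF that(5)]) (auto simp: dist_commute subset_iff)
  have *: "\<exists>a b. 0 < a \<and> a < h \<and> 0 < b \<and> b < h \<and>
      f (x + h *\<^sub>R axis k 1 + h *\<^sub>R axis l 1) - f (x + h *\<^sub>R axis k 1 + 0 *\<^sub>R axis l 1)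
      - f (x + 0 *\<^sub>R axis k 1 + h *\<^sub>R axis l 1) + f (x + 0 *\<^sub>R axis k 1 + 0 *\<^sub>R axis l 1)
      = h * h * partial l (partial k f) (x + a *\<^sub>R axis k 1 + b *\<^sub>R axis l 1)" for k l :: 'n
  proof (rule mixed_second_difference[OF h(1)])
    fix s t :: real assume st: "0 \<le> s" "s \<le> h" "0 \<le> t" "t \<le> h"
    show "((\<lambda>s. f (x + s *\<^sub>R axis k 1 + t *\<^sub>R axis l 1)) has_real_derivative
      partial k f (x + s *\<^sub>R axis k 1 + t *\<^sub>R axis l 1)) (at s)"
      using has_real_derivative_line[of f "x + t *\<^sub>R axis l 1" s k] diff[OF st f, of k l]
      by (simp add: add_ac)
    show "((\<lambda>t. partial k f (x + s *\<^sub>R axis k 1 + t *\<^sub>R axis l 1)) has_real_derivative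
      partial l (partial k f) (x + s *\<^sub>R axis k 1 + t *\<^sub>R axis l 1)) (at t)"
      using st diff f smooth_onD(2) by (intro has_real_derivative_line) blast
  qed
  obtain a b where ab: "0 < a" "a < h" "0 < b" "b < h"
    "f (x + h *\<^sub>R axis i 1 + h *\<^sub>R axis j 1) - f (x + h *\<^sub>R axis i 1) - f (x + h *\<^sub>R axis j 1) + f x
      = h * h * partial j (partial i f) (x + a *\<^sub>R axis i 1 + b *\<^sub>R axis j 1)"
    using *[of i j] by auto
  obtain a' b' where ab': "0 < a'" "a' < h" "0 < b'" "b' < h"
    "f (x + h *\<^sub>R axis j 1 + h *\<^sub>R axis i 1) - f (x + h *\<^sub>R axis j 1) - f (x + h *\<^sub>R axis i 1) + f x
      = h * h * partial i (partial j f) (x + a' *\<^sub>R axis j 1 + b' *\<^sub>R axis i 1)"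
    using *[of j i] by auto
  have "partial j (partial i f) (x + a *\<^sub>R axis i 1 + b *\<^sub>R axis j 1)
      = partial i (partial j f) (x + a' *\<^sub>R axis j 1 + b' *\<^sub>R axis i 1)" (is "?p = ?q")
  proof -
    have "h * h * ?p = h * h * ?q" using ab(5) ab'(5) by (simp add: add_ac algebra_simps)
    with h show ?thesis by simp
  qed
  moreover have "dist ?p (partial j (partial i f) x) < e"
    using ab h near[of a b i j] by (intro d(2)) auto
  moreover have "dist ?q (partial i (partial j f) x) < e"
    using ab' h near[of a' b' j i] by (intro d(2)) auto
  ultimately show False unfolding e_def dist_real_def by argo
qed

lemma commutator_eq_first_order:
  fixes f :: "real ^ 'n::finite \<Rightarrow> real"
  assumes U: "open U" "x \<in> U" and f: "smooth_on U f"
    and V: "V differentiable (at x)" "V' differentiable (at x)"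
  shows "commutator V V' f x =
    (\<Sum>k\<in>UNIV. (vf_op V (\<lambda>y. V' y $ k) x - vf_op V' (\<lambda>y. V y $ k) x) * partial k f x)"
proof -
  have comp: "(\<lambda>y. W y $ k) differentiable (at x)" if "W differentiable (at x)"
    for W :: "real ^ 'n \<Rightarrow> real ^ 'n" and k
    using that bounded_linear.has_derivative[OF bounded_linear_vec_nth]
    unfolding differentiable_def by blast
  \<comment> \<open>The product rule differentiates only the inner field \<open>W'\<close>. The
    statement is general in both fields since it is used for both orders of composition.\<close>
  have second: "vf_op W (vf_op W' f) x =
      (\<Sum>k\<in>UNIV. vf_op W (\<lambda>y. W' y $ k) x * partial k f x)
      + (\<Sum>j\<in>UNIV. \<Sum>k\<in>UNIV. W x $ j * W' x $ k * partial j (partial k f) x)"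
    if "W' differentiable (at x)" for W W' :: "real ^ 'n \<Rightarrow> real ^ 'n"
  proof -
    have d: "partial k f differentiable (at x)" for k
      using smooth_onD U f by blast
    have "partial j (vf_op W' f) x = (\<Sum>k\<in>UNIV. W' x $ k * partial j (partial k f) x
        + partial j (\<lambda>y. W' y $ k) x * partial k f x)" for j
      unfolding vf_op_def using comp[OF that] d
      by (simp add: partial_sum partial_mult differentiable_mult)
    then have "vf_op W (vf_op W' f) x = (\<Sum>j\<in>UNIV. \<Sum>k\<in>UNIV.
        W x $ j * partial j (\<lambda>y. W' y $ k) x * partial k f x)
        + (\<Sum>j\<in>UNIV. \<Sum>k\<in>UNIV. W x $ j * W' x $ k * partial j (partial k f) x)"
      by (simp add: vf_op_def[of W "vf_op W' f"] sum_distrib_left distrib_left sum.distrib mult_ac)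
    also have "(\<Sum>j\<in>UNIV. \<Sum>k\<in>UNIV. W x $ j * partial j (\<lambda>y. W' y $ k) x * partial k f x)
        = (\<Sum>k\<in>UNIV. vf_op W (\<lambda>y. W' y $ k) x * partial k f x)"
      by (subst sum.swap) (simp add: vf_op_def sum_distrib_right)
    finally show ?thesis .
  qed
  have "(\<Sum>j\<in>UNIV. \<Sum>k\<in>UNIV. V x $ j * V' x $ k * partial j (partial k f) x)
      = (\<Sum>j\<in>UNIV. \<Sum>k\<in>UNIV. V' x $ j * V x $ k * partial j (partial k f) x)"
    by (subst sum.swap) (simp add: partial_commute[OF U f] mult_ac cong: sum.cong)
  then show ?thesis
    by (simp add: commutator_def second V sum_subtractf left_diff_distrib)
qed

section \<open>Monomial fields on the upper half plane\<close>

text \<open>Values in any normed space let one formula serve whole vector fields, their components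
  and the diffusion coefficients. The shape of \<open>f\<close> is required only above the axis,
  because these functions are given through \<open>pos_part\<close>; the half plane is open, so the
  derivative does not see the rest.\<close>

lemma has_derivative_monomial:
  fixes u w :: "'b::real_normed_vector" and x :: "real ^ 2"
  assumes f: "\<And>y. y $ 2 > 0 \<Longrightarrow> f y = y $ 2 powr a *\<^sub>R (y $ 1 *\<^sub>R u + w)" and x: "x $ 2 > 0"
  shows "(f has_derivative (\<lambda>v. (x $ 2 powr a * v $ 1) *\<^sub>R u
    + (v $ 2 * (a * x $ 2 powr (a - 1))) *\<^sub>R (x $ 1 *\<^sub>R u + w))) (at x)"
proof -
  have "((\<lambda>y. y $ 2 powr a *\<^sub>R (y $ 1 *\<^sub>R u + w)) has_derivative (\<lambda>v. (x $ 2 powr a * v $ 1) *\<^sub>R u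
    + (v $ 2 * (a * x $ 2 powr (a - 1))) *\<^sub>R (x $ 1 *\<^sub>R u + w))) (at x)"
    using x by (auto intro!: derivative_eq_intros bounded_linear_imp_has_derivative
      bounded_linear_vec_nth simp: powr_diff fun_eq_iff algebra_simps add_divide_distrib)
  moreover have "open {y :: real ^ 2. y $ 2 > 0}"
    by (intro open_Collect_less continuous_intros)
  ultimately show ?thesis
    by (rule has_derivative_transform_within_open) (use x f in auto)
qed

lemma partial_monomial:
  fixes u w :: "'b::real_normed_vector" and x :: "real ^ 2"
  assumes f: "\<And>y. y $ 2 > 0 \<Longrightarrow> f y = y $ 2 powr a *\<^sub>R (y $ 1 *\<^sub>R u + w)" and x: "x $ 2 > 0"
  shows "partial 1 f x = x $ 2 powr a *\<^sub>R u"
    and "partial 2 f x = (a * x $ 2 powr (a - 1)) *\<^sub>R (x $ 1 *\<^sub>R u + w)"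
  by (simp_all add: partial_has_derivative[OF has_derivative_monomial[OF f x]] axis_def)

lemma smooth_on_monomial:
  fixes u w :: "'b::real_normed_vector"
  assumes f: "\<And>y. y $ 2 > 0 \<Longrightarrow> f y = y $ 2 powr a *\<^sub>R (y $ 1 *\<^sub>R u + w)"
  shows "smooth_on {x :: real ^ 2. x $ 2 > 0} f"
proof -
  \<comment> \<open>The exponent and both coefficients are quantified because a partial derivative
    changes them: direction 1 turns (a, u, w) into (a, 0, u), direction 2 into (a - 1, a u, a
    w).\<close>
  define X where "X g \<longleftrightarrow> (\<exists>a (u::'b) w. \<forall>y :: real ^ 2. y $ 2 > 0 \<longrightarrow>
    g y = y $ 2 powr a *\<^sub>R (y $ 1 *\<^sub>R u + w))" for g
  have "X f" unfolding X_def using f by blast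
  then show ?thesis
  proof (coinduction arbitrary: f)
    case (smooth_on f)
    then obtain a u w where f: "\<And>y. y $ 2 > 0 \<Longrightarrow> f y = y $ 2 powr a *\<^sub>R (y $ 1 *\<^sub>R u + w)"
      unfolding X_def by blast
    have "X (partial 1 f)"
      unfolding X_def using partial_monomial(1)[OF f]
      by (intro exI[of _ a] exI[of _ 0] exI[of _ u]) auto
    moreover have "X (partial 2 f)"
      unfolding X_def using partial_monomial(2)[OF f]
      by (intro exI[of _ "a - 1"] exI[of _ "a *\<^sub>R u"] exI[of _ "a *\<^sub>R w"]) (auto simp: algebra_simps)
    ultimately have "X (partial i f)" for i
      using exhaust_2[of i] by auto
    with has_derivative_monomial[OF f] show ?case
      by (auto simp: differentiable_def)
  qed
qed

section \<open>The Heston brackets and the Witt condition\<close>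

lemma vector_2_eq: "vector [a, b] = (a *\<^sub>R axis 1 1 + b *\<^sub>R axis 2 1 :: real ^ 2)"
  by (simp add: vec_eq_iff forall_2 axis_def)

lemma vec2_eqI: "x $ 1 = y $ 1 \<Longrightarrow> x $ 2 = y $ 2 \<Longrightarrow> x = (y :: 'a ^ 2)"
  by (simp add: vec_eq_iff forall_2)

lemma heston_M_component: "heston_M n x $ 1 = 2 * x $ 1 * pos_part (x $ 2) powr (1 - real n / 2)"
  "heston_M n x $ 2 = 0"
  and heston_L_component: "heston_L n x $ 1 = 0"
  "heston_L n x $ 2 = 2 * pos_part (x $ 2) powr (1 - real n / 2)"
  by (simp_all add: heston_M_def heston_L_def)

lemma heston_M_eq_0: "x $ 2 \<le> 0 \<Longrightarrow> heston_M n x = 0"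
  and heston_L_eq_0: "x $ 2 \<le> 0 \<Longrightarrow> heston_L n x = 0"
  by (auto intro!: vec2_eqI simp: heston_M_component heston_L_component pos_part_def max_absorb2)

lemma heston_M_monomial: "y $ 2 > 0 \<Longrightarrow>
    heston_M n y = y $ 2 powr (1 - real n / 2) *\<^sub>R (y $ 1 *\<^sub>R axis 1 2 + 0)"
  and heston_L_monomial: "y $ 2 > 0 \<Longrightarrow>
    heston_L n y = y $ 2 powr (1 - real n / 2) *\<^sub>R (y $ 1 *\<^sub>R 0 + axis 2 2)"
  by (auto intro!: vec2_eqI simp: heston_M_component heston_L_component pos_part_def axis_def)

lemma smooth_on_heston_W: "smooth_on {x. x $ 2 > 0} (heston_W n)"
  using smooth_on_monomial[OF heston_M_monomial] smooth_on_monomial[OF heston_L_monomial]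
  unfolding heston_W_def by (cases "even n") auto

lemma vf_op_heston_M: "x $ 2 > 0 \<Longrightarrow>
    vf_op (heston_M n) f x = 2 * x $ 1 * x $ 2 powr (1 - real n / 2) * partial 1 f x"
  and vf_op_heston_L: "x $ 2 > 0 \<Longrightarrow>
    vf_op (heston_L n) f x = 2 * x $ 2 powr (1 - real n / 2) * partial 2 f x"
  by (simp_all add: vf_op_def sum_2 heston_M_component heston_L_component pos_part_def)

lemma partial_heston:
  assumes x: "x $ 2 > 0"
  shows "partial 1 (\<lambda>y. heston_M n y $ 1) x = 2 * x $ 2 powr (1 - real n / 2)"
    and "partial 2 (\<lambda>y. heston_M n y $ 1) x = (2 - real n) * x $ 1 * x $ 2 powr (- real n / 2)"
    and "partial i (\<lambda>y. heston_M n y $ 2) x = 0"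
    and "partial i (\<lambda>y. heston_L n y $ 1) x = 0"
    and "partial 1 (\<lambda>y. heston_L n y $ 2) x = 0"
    and "partial 2 (\<lambda>y. heston_L n y $ 2) x = (2 - real n) * x $ 2 powr (- real n / 2)"
proof -
  have M: "heston_M n y $ 1 = y $ 2 powr (1 - real n / 2) *\<^sub>R (y $ 1 *\<^sub>R 2 + 0)" if "y $ 2 > 0" for y
    using that by (simp add: heston_M_component pos_part_def)
  have L: "heston_L n y $ 2 = y $ 2 powr (1 - real n / 2) *\<^sub>R (y $ 1 *\<^sub>R 0 + 2)" if "y $ 2 > 0" for y
    using that by (simp add: heston_L_component pos_part_def)
  have "partial i (\<lambda>y. 0 :: real) x = 0" for i and x :: "real ^ 2"
    by (simp add: partial_def)
  then show "partial i (\<lambda>y. heston_M n y $ 2) x = 0" "partial i (\<lambda>y. heston_L n y $ 1) x = 0"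
    by (simp_all add: heston_M_component heston_L_component)
  show "partial 1 (\<lambda>y. heston_M n y $ 1) x = 2 * x $ 2 powr (1 - real n / 2)"
    "partial 2 (\<lambda>y. heston_M n y $ 1) x = (2 - real n) * x $ 1 * x $ 2 powr (- real n / 2)"
    using partial_monomial[OF M x] by (simp_all add: algebra_simps)
  show "partial 1 (\<lambda>y. heston_L n y $ 2) x = 0"
    "partial 2 (\<lambda>y. heston_L n y $ 2) x = (2 - real n) * x $ 2 powr (- real n / 2)"
    using partial_monomial[OF L x] by (simp_all add: algebra_simps)
qed

text \<open>On the open lower half plane both fields vanish at the base point, so only the upper half
  plane needs a computation.\<close>

lemma bracket_onI_upper:
  fixes V V' Z :: "real ^ 2 \<Rightarrow> real ^ 2"
  assumes U: "open U" "U \<subseteq> {x. x $ 2 \<noteq> 0}"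
    and zero: "\<And>x. x $ 2 < 0 \<Longrightarrow> V x = 0 \<and> V' x = 0 \<and> Z x = 0"
    and diff: "\<And>x. x $ 2 > 0 \<Longrightarrow> V differentiable (at x) \<and> V' differentiable (at x)"
    and eq: "\<And>x k. x $ 2 > 0 \<Longrightarrow>
      vf_op V (\<lambda>y. V' y $ k) x - vf_op V' (\<lambda>y. V y $ k) x = Z x $ k"
  shows "bracket_on U V V' Z"
  unfolding bracket_on_def
proof (intro allI impI ballI)
  fix f :: "real ^ 2 \<Rightarrow> real" and x :: "real ^ 2"
  assume f: "smooth_on U f" and x: "x \<in> U"
  show "commutator V V' f x = vf_op Z f x"
  proof (cases "x $ 2 < 0")
    case True
    with zero show ?thesis by (simp add: vf_op_def commutator_def)
  next
    case False
    with U x have "x $ 2 > 0" by force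
    with commutator_eq_first_order[OF U(1) x f] diff eq show ?thesis
      by (simp add: vf_op_def[of Z])
  qed
qed

text \<open>The set is a parameter because the brackets are needed both off the axis and on the
  upper half plane. A smaller set admits more test functions, so the second case is not a mere
  restriction of the first.\<close>

context
  fixes U :: "(real ^ 2) set"
  assumes U: "open U" "U \<subseteq> {x. x $ 2 \<noteq> 0}"
begin

lemma bracket_heston:
  shows "bracket_on U (heston_M n) (heston_M m) (\<lambda>x. 0)"
    and "bracket_on U (heston_M n) (heston_L m) (\<lambda>x. (real n - 2) *\<^sub>R heston_M (n + m) x)"
    and "bracket_on U (heston_L m) (heston_M n) (\<lambda>x. (2 - real n) *\<^sub>R heston_M (n + m) x)"
    and "bracket_on U (heston_L n) (heston_L m)
      (\<lambda>x. (real n - real m) *\<^sub>R heston_L (n + m) x)"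
proof -
  have diff: "heston_M n differentiable (at x)" "heston_L n differentiable (at x)"
    if "x $ 2 > 0" for n and x :: "real ^ 2"
    using has_derivative_monomial[OF heston_M_monomial that]
      has_derivative_monomial[OF heston_L_monomial that] by (auto simp: differentiable_def)
  \<comment> \<open>Differentiation lowers one exponent by 1, and the exponents then add up to the
    one of index \<open>n + m\<close>. This is why the indices of the brackets add.\<close>
  have split: "z powr (1 - real m / 2) * z powr (- real n / 2) = z powr (1 - real (n + m) / 2)" for n m z
    by (simp flip: powr_add) (simp add: add_divide_distrib algebra_simps)
  note component = heston_M_component heston_L_component
  have bracket: "vf_op (heston_M n) (\<lambda>y. heston_M m y $ k) x
        - vf_op (heston_M m) (\<lambda>y. heston_M n y $ k) x = 0"
    "vf_op (heston_M n) (\<lambda>y. heston_L m y $ k) x - vf_op (heston_L m) (\<lambda>y. heston_M n y $ k) x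
        = (real n - 2) * heston_M (n + m) x $ k"
    "vf_op (heston_L n) (\<lambda>y. heston_L m y $ k) x - vf_op (heston_L m) (\<lambda>y. heston_L n y $ k) x
        = (real n - real m) * heston_L (n + m) x $ k"
    if x: "x $ 2 > 0" for x and k :: 2 and n m
  proof -
    have p: "pos_part (x $ 2) = x $ 2" using x by (simp add: pos_part_def)
    note rules = vf_op_heston_M[OF x] vf_op_heston_L[OF x] partial_heston[OF x]
    consider "k = 1" | "k = 2" using exhaust_2 by blast
    note k = this
    \<comment> \<open>Both terms equal 4 x1 times the same product of powers of x2 when
      \<open>k = 1\<close>, and vanish when \<open>k = 2\<close>.\<close>
    show "vf_op (heston_M n) (\<lambda>y. heston_M m y $ k) x
        - vf_op (heston_M m) (\<lambda>y. heston_M n y $ k) x = 0"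
      by (cases rule: k) (simp_all only: rules, simp_all)
    have *: "2 * x $ 2 powr (1 - real m / 2) * ((2 - real n) * a * x $ 2 powr (- real n / 2))
        = 2 * (2 - real n) * a * x $ 2 powr (1 - real (n + m) / 2)" for n m a
      unfolding split[symmetric] by (simp only: mult_ac)
    have **: "2 * x $ 2 powr (1 - real m / 2) * ((2 - real n) * x $ 2 powr (- real n / 2))
        = 2 * (2 - real n) * x $ 2 powr (1 - real (n + m) / 2)" for n m
      unfolding split[symmetric] by (simp only: mult_ac)
    show "vf_op (heston_M n) (\<lambda>y. heston_L m y $ k) x
        - vf_op (heston_L m) (\<lambda>y. heston_M n y $ k) x = (real n - 2) * heston_M (n + m) x $ k"
      by (cases rule: k) (simp_all only: rules *, simp_all add: component p algebra_simps)
    show "vf_op (heston_L n) (\<lambda>y. heston_L m y $ k) x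
        - vf_op (heston_L m) (\<lambda>y. heston_L n y $ k) x
        = (real n - real m) * heston_L (n + m) x $ k"
      by (cases rule: k) (simp_all only: rules **, simp_all add: component p algebra_simps)
  qed
  note facts = heston_M_eq_0 heston_L_eq_0 diff bracket
  show "bracket_on U (heston_M n) (heston_M m) (\<lambda>x. 0)"
    by (rule bracket_onI_upper[OF U]) (simp_all add: facts)
  show "bracket_on U (heston_M n) (heston_L m) (\<lambda>x. (real n - 2) *\<^sub>R heston_M (n + m) x)"
    by (rule bracket_onI_upper[OF U]) (simp_all add: facts)
  show "bracket_on U (heston_L m) (heston_M n) (\<lambda>x. (2 - real n) *\<^sub>R heston_M (n + m) x)"
  proof (rule bracket_onI_upper[OF U])
    show "vf_op (heston_L m) (\<lambda>y. heston_M n y $ k) x - vf_op (heston_M n) (\<lambda>y. heston_L m y $ k) x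
        = ((2 - real n) *\<^sub>R heston_M (n + m) x) $ k" if "x $ 2 > 0" for x k
      using bracket(2)[OF that, of n m k] by (simp add: left_diff_distrib)
  qed (simp_all add: facts)
  show "bracket_on U (heston_L n) (heston_L m) (\<lambda>x. (real n - real m) *\<^sub>R heston_L (n + m) x)"
    by (rule bracket_onI_upper[OF U]) (simp_all add: facts)
qed

lemma bracket_heston_W:
  "bracket_on U (heston_W n) (heston_W m) (\<lambda>x. heston_c n m *\<^sub>R heston_W (n + m) x)"
proof -
  consider a b where "n = 2 * a" "m = 2 * b" | a b where "n = 2 * a" "m = 2 * b + 1"
    | a b where "n = 2 * a + 1" "m = 2 * b" | a b where "n = 2 * a + 1" "m = 2 * b + 1"
    by (cases "even n"; cases "even m"; elim evenE oddE) blast+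
  then show ?thesis
  proof cases
    case 1
    then have "heston_c n m = real a - real b" "(n + m) div 2 = a + b"
      by (simp_all add: heston_c_def)
    then show ?thesis using bracket_heston(4)[of a b] 1
      by (simp add: heston_W_def)
  next
    case 2
    then have "heston_c n m = 2 - real b"
      by (simp add: heston_c_def field_simps)
    then show ?thesis using bracket_heston(3)[of a b] 2
      by (simp add: heston_W_def add.commute)
  next
    case 3
    then have "heston_c n m = real a - 2"
      by (simp add: heston_c_def field_simps)
    then show ?thesis using bracket_heston(2)[of a b] 3
      by (simp add: heston_W_def)
  next
    \<comment> \<open>Here \<open>n + m\<close> is even, so \<open>heston_W (n + m)\<close> is a
      field of type L; the coefficient 0 makes this irrelevant.\<close>
    case 4
    then show ?thesis using bracket_heston(1)[of a b]
      by (simp add: heston_W_def heston_c_def)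
  qed
qed

end

section \<open>The Heston fields as combinations of the W_n\<close>

lemma heston_field_1:
  "heston_field \<mu> \<kappa> \<theta> \<xi> \<rho> 1 x = (1 / 2) *\<^sub>R heston_W 3 x + (\<xi> * \<rho> / 2) *\<^sub>R heston_W 2 x"
  by (rule vec2_eqI) (auto simp: heston_field_def sde_field_def heston_diffusion_def heston_W_def
    heston_M_component heston_L_component pos_part_def powr_half_sqrt)

lemma heston_field_2:
  "heston_field \<mu> \<kappa> \<theta> \<xi> \<rho> 2 x = (\<xi> * sqrt (1 - \<rho>\<^sup>2) / 2) *\<^sub>R heston_W 2 x"
  by (rule vec2_eqI) (auto simp: heston_field_def sde_field_def heston_diffusion_def heston_W_def
    heston_M_component heston_L_component pos_part_def powr_half_sqrt)

text \<open>The diffusion fields involve only the square root of the positive part, so their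
  formulas hold on the whole plane. The drift also contains \<open>\<mu> * x $ 1\<close> and
  \<open>\<kappa> * \<theta>\<close>, which survive below the axis where all
  \<open>heston_W k\<close> vanish; hence the restriction to x2 > 0.\<close>

lemma heston_field_0:
  assumes \<rho>: "\<bar>\<rho>\<bar> \<le> 1" and x: "x $ 2 > 0"
  shows "heston_field \<mu> \<kappa> \<theta> \<xi> \<rho> 0 x =
    (1 / 2 * (\<mu> - \<xi> * \<rho> / 4)) *\<^sub>R heston_W 5 x - (1 / 4) *\<^sub>R heston_W 1 x
    + (1 / 2 * (\<kappa> * \<theta> - \<xi>\<^sup>2 / 4)) *\<^sub>R heston_W 4 x - (\<kappa> / 2) *\<^sub>R heston_W 0 x"
proof -
  define s where "s = sqrt (x $ 2)"
  have s: "s > 0" "x $ 2 = s * s" using x by (simp_all add: s_def)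
  have \<sigma>: "heston_diffusion \<xi> \<rho> 1 y $ 1 = y $ 2 powr (1/2) *\<^sub>R (y $ 1 *\<^sub>R 1 + 0)"
    "heston_diffusion \<xi> \<rho> 1 y $ 2 = y $ 2 powr (1/2) *\<^sub>R (y $ 1 *\<^sub>R 0 + \<xi> * \<rho>)"
    "heston_diffusion \<xi> \<rho> 2 y $ 1 = y $ 2 powr (1/2) *\<^sub>R (y $ 1 *\<^sub>R 0 + 0)"
    "heston_diffusion \<xi> \<rho> 2 y $ 2 = y $ 2 powr (1/2) *\<^sub>R (y $ 1 *\<^sub>R 0 + \<xi> * sqrt (1 - \<rho>\<^sup>2))"
    if "y $ 2 > 0" for y
    using that by (auto simp: heston_diffusion_def pos_part_def powr_half_sqrt)
  note d = \<sigma>[THEN partial_monomial(1), OF _ x] \<sigma>[THEN partial_monomial(2), OF _ x]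
  have "s / x $ 2 = 1 / s" unfolding s(2) using s(1) by simp
  then have powr: "x $ 2 powr (1/2) = s" "x $ 2 powr (- (1/2)) = 1 / s"
    using x by (simp_all add: powr_half_sqrt powr_minus_divide flip: s_def)
  \<comment> \<open>The bound on the correlation enters here: it makes the square of
    \<open>sqrt (1 - \<rho> * \<rho>)\<close> equal to the radicand.\<close>
  have r: "\<bar>1 - \<rho> * \<rho>\<bar> = 1 - \<rho> * \<rho>"
    "sqrt (1 - \<rho> * \<rho>) * (sqrt (1 - \<rho> * \<rho>) * z) = (1 - \<rho> * \<rho>) * z" for z
    using \<rho> by (simp_all add: abs_square_le_1 flip: power2_eq_square mult.assoc)
  \<comment> \<open>In the second component the two noises contribute \<xi>^2 \<rho>^2 / 2 and
    \<xi>^2 (1 - \<rho>^2) / 2, so \<rho> cancels. The factor 1/2 of the Ito correction then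
    produces the constants \<xi> \<rho> / 4 and \<xi>^2 / 4.\<close>
  have corr: "(\<Sum>l=1..2. \<Sum>j\<in>UNIV. heston_diffusion \<xi> \<rho> l x $ j * partial j (\<lambda>y. heston_diffusion \<xi> \<rho> l y $ k) x)
      = (if k = 1 then s * s * x $ 1 + \<xi> * \<rho> / 2 * x $ 1 else \<xi>\<^sup>2 / 2)" for k :: 2
  proof -
    have "{1..2::nat} = {1, 2}" by auto
    moreover have "k = 1 \<or> k = 2" by (rule exhaust_2)
    ultimately show ?thesis
      using s(1) by (elim disjE)
        (simp_all add: sum_2 \<sigma>[OF x] d powr r power2_eq_square algebra_simps del: One_nat_def,
          simp add: field_simps)
  qed
  have W: "heston_W 5 x $ 1 = 2 * x $ 1" "heston_W 1 x $ 1 = 2 * x $ 1 * x $ 2"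
    "heston_W 4 x $ 1 = 0" "heston_W 0 x $ 1 = 0" "heston_W 5 x $ 2 = 0" "heston_W 1 x $ 2 = 0"
    "heston_W 4 x $ 2 = 2" "heston_W 0 x $ 2 = 2 * x $ 2"
    using x by (simp_all add: heston_W_def heston_M_component heston_L_component pos_part_def)
  have field: "heston_field \<mu> \<kappa> \<theta> \<xi> \<rho> 0 x $ 1 = \<mu> * x $ 1 - (x $ 2 * x $ 1 + \<xi> * \<rho> / 2 * x $ 1) / 2"
    "heston_field \<mu> \<kappa> \<theta> \<xi> \<rho> 0 x $ 2 = \<kappa> * (\<theta> - x $ 2) - \<xi>\<^sup>2 / 4"
    using x unfolding heston_field_def sde_field_def by (simp_all add: corr heston_drift_def pos_part_def s(2) del: One_nat_def)
  show ?thesis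
    by (rule vec2_eqI) (simp_all add: W field algebra_simps del: One_nat_def)
qed

lemma witt_condition_heston:
  assumes "\<bar>\<rho>\<bar> \<le> 1"
  shows "witt_condition_on {x. x $ 2 > 0} 2 (heston_field \<mu> \<kappa> \<theta> \<xi> \<rho>)"
  unfolding witt_condition_on_def
proof (rule exI[of _ heston_W], rule exI[of _ heston_c], intro conjI allI impI)
  show "smooth_on {x. 0 < x $ 2} (heston_W n)" for n
    by (rule smooth_on_heston_W)
  show "bracket_on {x. 0 < x $ 2} (heston_W n) (heston_W m)
      (\<lambda>x. heston_c n m *\<^sub>R heston_W (n + m) x)" for n m
    by (rule bracket_heston_W) (auto intro!: open_Collect_less continuous_intros)
  fix i :: nat assume "i \<le> 2"
  then consider "i = 0" | "i = 1" | "i = 2" by linarith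
  then show "\<exists>S c. finite S \<and> (\<forall>x\<in>{x. 0 < x $ 2}.
      heston_field \<mu> \<kappa> \<theta> \<xi> \<rho> i x = (\<Sum>n\<in>S. c n *\<^sub>R heston_W n x))"
  proof cases
    case 1
    then show ?thesis
      by (intro exI[of _ "{0, 1, 4, 5}"] exI[of _ "(\<lambda>_. 0)(0 := - \<kappa> / 2, 1 := - 1 / 4,
        4 := 1 / 2 * (\<kappa> * \<theta> - \<xi>\<^sup>2 / 4), 5 := 1 / 2 * (\<mu> - \<xi> * \<rho> / 4))"])
        (simp add: heston_field_0[OF assms])
  next
    case 2
    then show ?thesis
      by (intro exI[of _ "{2, 3}"] exI[of _ "(\<lambda>_. 0)(2 := \<xi> * \<rho> / 2, 3 := 1 / 2)"])
        (simp add: heston_field_1[unfolded One_nat_def])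
  next
    case 3
    then show ?thesis
      by (intro exI[of _ "{2}"] exI[of _ "\<lambda>_. \<xi> * sqrt (1 - \<rho>\<^sup>2) / 2"])
        (simp add: heston_field_2)
  qed
qed

section \<open>Piecewise solutions on segments\<close>

lemma pw_ode_solution_subset:
  assumes "pw_ode_solution W T u" "T' \<subseteq> T"
  shows "pw_ode_solution W T' u"
proof -
  obtain F where "continuous_on T u" "finite F"
    "\<And>s. s \<in> T - F \<Longrightarrow> (u has_vector_derivative W (u s)) (at s within T)"
    using assms(1) unfolding pw_ode_solution_def by blast
  with assms(2) show ?thesis unfolding pw_ode_solution_def
    by (intro conjI exI[of _ F] ballI)
      (auto intro: continuous_on_subset has_vector_derivative_within_subset)
qed

lemma ode_solution_imp_pw:
  assumes "ode_solution W T u"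
  shows "pw_ode_solution W T u"
  using assms unfolding pw_ode_solution_def ode_solution_def
  by (auto intro!: exI[of _ "{}"] has_vector_derivative_continuous
    simp: continuous_on_eq_continuous_within)

text \<open>Continuity carries the constant value across the finitely many points of
  \<open>F\<close>.\<close>

lemma pw_constant:
  fixes f :: "real \<Rightarrow> real"
  assumes "finite F" "continuous_on (closed_segment a b) f"
    and "\<And>s. s \<in> closed_segment a b - F \<Longrightarrow> (f has_vector_derivative 0) (at s within closed_segment a b)"
  shows "f b = f a"
  by (rule has_derivative_zero_unique_strong_convex[OF convex_closed_segment assms(1,2)])
    (use assms(3) in \<open>auto simp: has_vector_derivative_def\<close>)

text \<open>The increment is the integral of a nonnegative function, by a form of the fundamental
  theorem that tolerates a finite exceptional set.\<close>

lemma pw_nondecreasing: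
  fixes f :: "real \<Rightarrow> real"
  assumes F: "finite F" and ab: "a \<le> b" and f: "continuous_on {a..b} f"
    and f': "\<And>s. s \<in> {a..b} - F \<Longrightarrow> (f has_vector_derivative f' s) (at s within {a..b})"
    and nonneg: "\<And>s. 0 \<le> f' s"
  shows "f a \<le> f b"
proof -
  have "(f' has_integral f b - f a) {a..b}"
  proof (rule fundamental_theorem_of_calculus_interior_strong[OF F ab _ f])
    fix s assume "s \<in> {a<..<b} - F"
    then show "(f has_vector_derivative f' s) (at s)"
      using f'[of s] at_within_Icc_at[of a s b] by simp
  qed
  from has_integral_nonneg[OF this nonneg] show ?thesis by simp
qed

lemma pw_ode_solution_component:
  fixes W :: "real ^ 'n \<Rightarrow> real ^ 'n"
  assumes "pw_ode_solution W T u" and W: "\<And>y. W y $ k = w (y $ k)"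
  shows "pw_ode_solution w T (\<lambda>s. u s $ k)"
proof -
  obtain F where "continuous_on T u" "finite F"
    "\<And>s. s \<in> T - F \<Longrightarrow> (u has_vector_derivative W (u s)) (at s within T)"
    using assms(1) unfolding pw_ode_solution_def by blast
  then show ?thesis unfolding pw_ode_solution_def W[symmetric]
    by (intro conjI exI[of _ F] ballI continuous_on_component
      bounded_linear.has_vector_derivative[OF bounded_linear_vec_nth]) auto
qed

lemma pw_ode_solution_zero_constant:
  fixes u :: "real \<Rightarrow> real"
  assumes "pw_ode_solution (\<lambda>_. 0) (closed_segment a b) u"
  shows "u b = u a"
proof -
  obtain F where "continuous_on (closed_segment a b) u" "finite F"
    "\<And>s. s \<in> closed_segment a b - F \<Longrightarrow> (u has_vector_derivative 0) (at s within closed_segment a b)"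
    using assms unfolding pw_ode_solution_def by blast
  then show ?thesis by (intro pw_constant) auto
qed

text \<open>\<open>flow\<close> selects an endpoint, so only the value at \<open>t\<close> has to be
  unique. Existence comes from restricting a global solution.\<close>

lemma flow_eqI:
  assumes "pw_ode_solution W UNIV u" "u 0 = x"
    and "\<And>v. pw_ode_solution W (closed_segment 0 t) v \<Longrightarrow> v 0 = x \<Longrightarrow> v t = u t"
  shows "flow W t x = u t"
  unfolding flow_def
proof (rule the_equality)
  show "\<exists>v. pw_ode_solution W (closed_segment 0 t) v \<and> v 0 = x \<and> v t = u t"
    using pw_ode_solution_subset[OF assms(1) subset_UNIV] assms(2) by blast
qed (use assms(3) in blast)

section \<open>The flow of \<open>M\<close>\<close>

lemma has_vector_derivative_vector_2:
  assumes "(f has_vector_derivative f') F" "(g has_vector_derivative g') F"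
  shows "((\<lambda>s. vector [f s, g s] :: real ^ 2) has_vector_derivative vector [f', g']) F"
  unfolding vector_2_eq using assms
  by (auto intro!: derivative_eq_intros simp: has_vector_derivative_def algebra_simps)

lemma tendsto_vector_2:
  fixes a b :: real
  assumes "(f \<longlongrightarrow> a) F" "(g \<longlongrightarrow> b) F"
  shows "((\<lambda>s. vector [f s, g s] :: real ^ 2) \<longlongrightarrow> vector [a, b]) F"
  unfolding vector_2_eq by (intro tendsto_intros assms)

lemma continuous_on_vector_2:
  fixes f g :: "'a::topological_space \<Rightarrow> real"
  assumes "continuous_on S f" "continuous_on S g"
  shows "continuous_on S (\<lambda>s. vector [f s, g s] :: real ^ 2)"
  using assms unfolding continuous_on_def by (auto intro: tendsto_vector_2)

lemma heston_M_flow_0: "heston_M_flow n 0 x = x"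
  by (rule vec2_eqI) (simp_all add: heston_M_flow_def)

text \<open>The flow fixes x2, so the coefficient \<open>c\<close> is constant in time and the first
  coordinate solves y' = c y.\<close>

lemma heston_M_flow_ode: "ode_solution (heston_M n) UNIV (\<lambda>s. heston_M_flow n s x)"
  unfolding ode_solution_def
proof
  fix s
  define c where "c = 2 * pos_part (x $ 2) powr (1 - real n / 2)"
  have "((\<lambda>s. x $ 1 * exp (c * s)) has_vector_derivative c * (x $ 1 * exp (c * s))) (at s)"
    by (auto intro!: derivative_eq_intros simp flip: has_real_derivative_iff_has_vector_derivative)
  from has_vector_derivative_vector_2[OF this has_vector_derivative_const]
  show "((\<lambda>s. heston_M_flow n s x) has_vector_derivative heston_M n (heston_M_flow n s x)) (at s)"
    by (simp add: heston_M_flow_def heston_M_def c_def mult_ac)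
qed

lemma flow_heston_M: "flow (heston_M n) t x = heston_M_flow n t x"
proof (rule flow_eqI[OF ode_solution_imp_pw[OF heston_M_flow_ode] heston_M_flow_0])
  let ?S = "closed_segment 0 t"
  fix v assume v: "pw_ode_solution (heston_M n) ?S v" "v 0 = x"
  define c where "c = 2 * pos_part (x $ 2) powr (1 - real n / 2)"
  have v2: "v s $ 2 = x $ 2" if "s \<in> ?S" for s
  proof -
    have "pw_ode_solution (heston_M n) (closed_segment 0 s) v"
      using that by (intro pw_ode_solution_subset[OF v(1)]) (simp add: subset_closed_segment)
    then have "v s $ 2 = v 0 $ 2"
      by (rule pw_ode_solution_zero_constant[OF pw_ode_solution_component])
        (simp add: heston_M_component)
    with v show ?thesis by simp
  qed
  obtain F where F: "finite F" "continuous_on ?S v"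
    "\<And>s. s \<in> ?S - F \<Longrightarrow> (v has_vector_derivative heston_M n (v s)) (at s within ?S)"
    using v(1) unfolding pw_ode_solution_def by blast
  \<comment> \<open>Integrating factor: with x2 frozen along the segment,
    \<open>exp (- c * s)\<close> makes the first coordinate constant.\<close>
  have "v t $ 1 * exp (- c * t) = v 0 $ 1 * exp (- c * 0)"
  proof (rule pw_constant[OF F(1), where f = "\<lambda>s. v s $ 1 * exp (- c * s)"])
    show "continuous_on ?S (\<lambda>s. v s $ 1 * exp (- c * s))"
      by (intro continuous_intros F)
    fix s assume s: "s \<in> ?S - F"
    have "((\<lambda>s. v s $ 1) has_real_derivative c * v s $ 1) (at s within ?S)"
      using bounded_linear.has_vector_derivative[OF bounded_linear_vec_nth[of 1] F(3)[OF s]] s v2[of s]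
      by (simp add: has_real_derivative_iff_has_vector_derivative heston_M_component c_def mult_ac)
    then show "((\<lambda>s. v s $ 1 * exp (- c * s)) has_vector_derivative 0) (at s within ?S)"
      unfolding has_real_derivative_iff_has_vector_derivative[symmetric]
      by (auto intro!: derivative_eq_intros)
  qed
  then have "v t $ 1 = x $ 1 * exp (c * t)"
    using v(2) by (simp add: exp_minus field_simps)
  then show "v t = heston_M_flow n t x"
    using v2[of t] by (intro vec2_eqI) (simp_all add: heston_M_flow_def c_def)
qed

section \<open>The scalar equation behind the flow of \<open>L\<close>\<close>

definition power_field :: "real \<Rightarrow> real \<Rightarrow> real" where
  "power_field p y = 2 * pos_part y powr (1 - p / 2)"

text \<open>For y > 0, (y^(p/2))' = (p/2) y^(p/2 - 1) * 2 y^(1 - p/2) = p. So the power moves at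
  speed p, is cut off at zero, and is converted back by the exponent 2/p.\<close>

definition power_flow :: "real \<Rightarrow> real \<Rightarrow> real \<Rightarrow> real" where
  "power_flow p t y = pos_part (p * t + pos_part y powr (p / 2)) powr (2 / p)"

lemma pos_part_of_pos: "0 \<le> a \<Longrightarrow> pos_part a = a"
  and pos_part_of_neg: "a \<le> 0 \<Longrightarrow> pos_part a = 0"
  and pos_part_nonneg: "0 \<le> pos_part a"
  by (simp_all add: pos_part_def)

lemma power_flow_0: "p > 0 \<Longrightarrow> power_flow p 0 y = pos_part y"
  by (simp add: power_flow_def pos_part_of_pos powr_powr pos_part_nonneg)

lemma power_field_nonneg: "0 \<le> power_field p y"
  by (simp add: power_field_def)

text \<open>Both exponents are positive, so the powers stay continuous at base 0. Time and initial
  value vary together: continuity in time serves the equation, continuity in the initial value the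
  limit from above.\<close>

lemma continuous_on_power_flow:
  assumes "p > 0" "continuous_on S f" "continuous_on S g"
  shows "continuous_on S (\<lambda>s. power_flow p (f s) (g s))"
  unfolding power_flow_def pos_part_def using assms
  by (intro continuous_intros continuous_on_powr') auto

text \<open>The excluded time is the one at which the flow leaves zero. There the slope from the
  right is 2 for p = 2 and infinite for p > 2, while the field is 0.\<close>

lemma power_flow_has_derivative:
  assumes p: "p > 0" and s: "p * s + pos_part y powr (p / 2) \<noteq> 0"
  shows "((\<lambda>s. power_flow p s y) has_vector_derivative power_field p (power_flow p s y)) (at s)"
proof -
  define c where "c = pos_part y powr (p / 2)"
  have flow: "power_flow p r y = pos_part (p * r + c) powr (2 / p)" for r
    by (simp add: power_flow_def c_def)
  show ?thesis
  proof (cases "p * s + c > 0")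
    case True
    have "((\<lambda>s. p * s + c) has_real_derivative p) (at s)"
      by (auto intro!: derivative_eq_intros)
    from DERIV_chain2[OF has_real_derivative_powr[OF True, of "2 / p"] this]
    have "((\<lambda>s. (p * s + c) powr (2 / p)) has_real_derivative 2 * (p * s + c) powr (2 / p - 1)) (at s)"
      using p by simp
    moreover have "open {s. p * s + c > 0}"
      by (intro open_Collect_less continuous_intros)
    ultimately have "((\<lambda>s. power_flow p s y) has_real_derivative 2 * (p * s + c) powr (2 / p - 1)) (at s)"
      by (rule has_field_derivative_transform_within_open)
        (use True in \<open>auto simp: flow pos_part_of_pos\<close>)
    moreover have "power_field p (power_flow p s y) = 2 * (p * s + c) powr (2 / p - 1)"
      using p True by (simp add: power_field_def flow pos_part_of_pos powr_powr right_diff_distrib)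
    ultimately show ?thesis by (simp add: has_real_derivative_iff_has_vector_derivative)
  next
    case False
    then have neg: "p * s + c < 0" using s by (simp add: c_def)
    have "((\<lambda>_. 0) has_real_derivative 0) (at s)" by simp
    moreover have "open {s. p * s + c < 0}"
      by (intro open_Collect_less continuous_intros)
    ultimately have "((\<lambda>s. power_flow p s y) has_real_derivative 0) (at s)"
      by (rule has_field_derivative_transform_within_open)
        (use neg in \<open>auto simp: flow pos_part_of_neg\<close>)
    with neg show ?thesis
      by (simp add: has_real_derivative_iff_has_vector_derivative flow power_field_def pos_part_of_neg)
  qed
qed

lemma power_flow_pw_ode:
  assumes "p > 0"
  shows "pw_ode_solution (power_field p) UNIV (\<lambda>s. power_flow p s y)"
  unfolding pw_ode_solution_def
proof (intro conjI exI ballI)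
  show "continuous_on UNIV (\<lambda>s. power_flow p s y)"
    by (intro continuous_on_power_flow assms continuous_intros)
  show "finite {- (pos_part y powr (p / 2)) / p}" by simp
  fix s assume "s \<in> UNIV - {- (pos_part y powr (p / 2)) / p}"
  with assms have "p * s + pos_part y powr (p / 2) \<noteq> 0"
    by (auto simp: field_simps eq_neg_iff_add_eq_0)
  then show "((\<lambda>s. power_flow p s y) has_vector_derivative power_field p (power_flow p s y)) (at s)"
    by (rule power_flow_has_derivative[OF assms])
qed

lemma power_ode_nondecreasing:
  assumes "pw_ode_solution (power_field p) {a..b} v" "a \<le> b"
  shows "v a \<le> v b"
proof -
  obtain F where "finite F" "continuous_on {a..b} v"
    "\<And>s. s \<in> {a..b} - F \<Longrightarrow> (v has_vector_derivative power_field p (v s)) (at s within {a..b})"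
    using assms(1) unfolding pw_ode_solution_def by blast
  from pw_nondecreasing[OF this(1) assms(2) this(2,3) power_field_nonneg]
  show ?thesis .
qed

text \<open>On positive solutions \<open>v powr (p / 2)\<close> has constant derivative \<open>p\<close>.\<close>

lemma power_ode_positive:
  assumes v: "pw_ode_solution (power_field p) (closed_segment a b) v"
    and pos: "\<And>s. s \<in> closed_segment a b \<Longrightarrow> v s > 0"
  shows "v b powr (p / 2) = v a powr (p / 2) + p * (b - a)"
proof -
  let ?S = "closed_segment a b"
  obtain F where F: "finite F" "continuous_on ?S v"
    "\<And>s. s \<in> ?S - F \<Longrightarrow> (v has_vector_derivative power_field p (v s)) (at s within ?S)"
    using v unfolding pw_ode_solution_def by blast
  have "v b powr (p / 2) - p * b = v a powr (p / 2) - p * a"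
  proof (rule pw_constant[OF F(1), where f = "\<lambda>s. v s powr (p / 2) - p * s"])
    show "continuous_on ?S (\<lambda>s. v s powr (p / 2) - p * s)"
      by (intro continuous_intros F) (use pos in force)
    fix s assume s: "s \<in> ?S - F"
    then have vs: "v s > 0" using pos by blast
    have "(v has_real_derivative 2 * v s powr (1 - p / 2)) (at s within ?S)"
      using F(3)[OF s] vs
      by (simp add: has_real_derivative_iff_has_vector_derivative power_field_def pos_part_of_pos)
    then have "((\<lambda>s. v s powr (p / 2) - p * s) has_real_derivative 0) (at s within ?S)"
      using vs by (auto intro!: derivative_eq_intros simp flip: powr_add)
    then show "((\<lambda>s. v s powr (p / 2) - p * s) has_vector_derivative 0) (at s within ?S)"
      by (simp add: has_real_derivative_iff_has_vector_derivative)
  qed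
  then show ?thesis by (simp add: algebra_simps)
qed

text \<open>A start at zero has to be excluded: from there both the constant 0 and
  \<open>power_flow p t 0\<close> are piecewise solutions.\<close>

lemma power_ode_unique_forward:
  assumes p: "p > 0" and v: "pw_ode_solution (power_field p) {0..t} v" and t: "0 \<le> t"
    and pos: "v 0 > 0"
  shows "v t = power_flow p t (v 0)"
proof -
  have vpos: "v s > 0" if "s \<in> {0..t}" for s
    using power_ode_nondecreasing[OF pw_ode_solution_subset[OF v], of 0 s] that pos by force
  have "v t powr (p / 2) = v 0 powr (p / 2) + p * (t - 0)"
    by (rule power_ode_positive) (use v vpos t in \<open>auto simp: closed_segment_eq_real_ivl\<close>)
  then have "power_flow p t (v 0) = (v t powr (p / 2)) powr (2 / p)"
    using p t pos by (simp add: power_flow_def pos_part_of_pos add.commute)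
  then show ?thesis
    using p vpos[of t] t by (simp add: powr_powr)
qed

text \<open>Backwards in time a solution stays nonnegative, since it could only become negative where the
  field vanishes, and it cannot reach zero before \<open>p s + v 0 powr (p / 2)\<close> does.\<close>

lemma power_ode_unique_backward:
  assumes p: "p > 0" and v: "pw_ode_solution (power_field p) {t..0} v" and t: "t \<le> 0"
    and nonneg: "v 0 \<ge> 0"
  shows "v t = power_flow p t (v 0)"
proof -
  have sub: "pw_ode_solution (power_field p) {a..b} v" if "t \<le> a" "b \<le> 0" for a b
    using pw_ode_solution_subset[OF v] that by simp
  have cont: "continuous_on {t..0} v" using v by (simp add: pw_ode_solution_def)
  have mono: "v a \<le> v b" if "t \<le> a" "a \<le> b" "b \<le> 0" for a b
    using power_ode_nondecreasing[OF sub] that by simp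
  define c where "c = v 0 powr (p / 2)"
  \<comment> \<open>By monotonicity, positivity at \<open>s\<close> spreads to all of
    \<open>{s..0}\<close>, so the linear law applies between \<open>s\<close> and 0.\<close>
  have pos: "v s powr (p / 2) = c + p * s" if "t \<le> s" "s \<le> 0" "v s > 0" for s
  proof -
    have "v 0 powr (p / 2) = v s powr (p / 2) + p * (0 - s)"
      using sub[of s 0] that mono[of s]
      by (intro power_ode_positive) (force simp: closed_segment_eq_real_ivl)+
    then show ?thesis by (simp add: c_def)
  qed
  have flow: "power_flow p t (v 0) = pos_part (p * t + c) powr (2 / p)"
    using nonneg by (simp add: power_flow_def c_def pos_part_of_pos)
  consider "v t < 0" | "v t = 0" | "v t > 0" by linarith
  then show ?thesis
  proof cases
    case 1
    \<comment> \<open>The level \<open>v t / 2\<close> is still negative. Up to the time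
      \<open>s\<close> where it is reached, monotonicity keeps \<open>v\<close> negative, so the
      field vanishes and \<open>v\<close> is constant, contradicting
      \<open>v s = v t / 2\<close>.\<close>
    have "\<exists>s\<ge>t. s \<le> 0 \<and> v s = v t / 2"
      by (rule IVT'[OF _ _ t cont]) (use 1 nonneg in auto)
    then obtain s where s: "t \<le> s" "s \<le> 0" "v s = v t / 2" by blast
    have "pw_ode_solution (\<lambda>_. 0) (closed_segment t s) v"
    proof -
      have "power_field p (v r) = 0" if "r \<in> {t..s}" for r
        using mono[of r s] s that 1 by (simp add: power_field_def pos_part_of_neg)
      with sub[of t s] s show ?thesis
        by (auto simp: pw_ode_solution_def closed_segment_eq_real_ivl)
    qed
    then have "v s = v t" by (rule pw_ode_solution_zero_constant)
    with s 1 show ?thesis by simp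
  next
    case 2
    have "p * t + c \<le> 0"
    proof (rule ccontr)
      assume "\<not> p * t + c \<le> 0"
      \<comment> \<open>The power of \<open>v\<close> rises from 0 at \<open>t\<close> to
        \<open>c\<close> at 0, so it takes the value \<open>(p * t + c) / 2\<close> at some
        \<open>s\<close>. There \<open>v s > 0\<close>, and the linear law gives
        \<open>c + p * s\<close>, which is at least \<open>p * t + c\<close> and hence too
        large.\<close>
      then have e: "0 < (p * t + c) / 2" by simp
      then have "0 < p * t + c" by simp
      moreover have "p * t + c \<le> c" using p t by (simp add: mult_nonneg_nonpos)
      ultimately have ec: "(p * t + c) / 2 \<le> c" by (simp only: le_divide_eq field_simps)
      have "continuous_on {t..0} (\<lambda>s. v s powr (p / 2))"
        using p mono[of t] 2 by (intro continuous_on_powr' cont continuous_intros) auto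
      then have "\<exists>s\<ge>t. s \<le> 0 \<and> v s powr (p / 2) = (p * t + c) / 2"
        by (intro IVT'[OF _ _ t]) (use 2 e ec in \<open>auto simp: c_def\<close>)
      then obtain s where s: "t \<le> s" "s \<le> 0" "v s powr (p / 2) = (p * t + c) / 2" by blast
      with e have "v s > 0" using mono[of t s] 2 by (cases "v s = 0") auto
      with pos s have "c + p * s = (p * t + c) / 2" by simp
      moreover have "p * t + c \<le> c + p * s" using p s by simp
      ultimately have "p * t + c \<le> (p * t + c) / 2" by simp
      moreover have "\<not> y \<le> y / 2" if "0 < y / 2" for y :: real using that by simp
      ultimately show False using e by blast
    qed
    with 2 show ?thesis by (simp add: flow pos_part_of_neg)
  next
    case 3
    with pos[of t] t have "v t powr (p / 2) = p * t + c" by simp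
    with 3 have "power_flow p t (v 0) = (v t powr (p / 2)) powr (2 / p)"
      unfolding flow by (metis pos_part_of_pos powr_ge_zero)
    with 3 p show ?thesis by (simp add: powr_powr)
  qed
qed

section \<open>The flow of \<open>L\<close>\<close>

lemma heston_L_flow_eq: "heston_L_flow n t x = vector [x $ 1, power_flow (real n) t (x $ 2)]"
  by (simp add: heston_L_flow_def power_flow_def)

lemma heston_L_eq: "heston_L n x = vector [0, power_field (real n) (x $ 2)]"
  by (simp add: heston_L_def power_field_def)

context
  fixes n :: nat
  assumes n: "n \<ge> 1"
begin

lemma heston_L_flow_0: "heston_L_flow n 0 x = vector [x $ 1, pos_part (x $ 2)]"
  using n by (simp add: heston_L_flow_eq power_flow_0)

lemma heston_L_flow_pw_ode: "pw_ode_solution (heston_L n) UNIV (\<lambda>s. heston_L_flow n s x)"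
proof -
  have "continuous_on UNIV (\<lambda>s. power_flow (real n) s (x $ 2))"
    using n by (intro continuous_on_power_flow continuous_intros) simp
  moreover obtain F where "finite F" "\<And>s. s \<in> UNIV - F \<Longrightarrow>
    ((\<lambda>s. power_flow (real n) s (x $ 2)) has_vector_derivative
      power_field (real n) (power_flow (real n) s (x $ 2))) (at s)"
    using power_flow_pw_ode[of "real n" "x $ 2"] n unfolding pw_ode_solution_def by auto
  ultimately show ?thesis
    unfolding pw_ode_solution_def heston_L_flow_eq heston_L_eq
    by (intro conjI exI[of _ F] ballI) (auto intro!: has_vector_derivative_vector_2
      continuous_on_vector_2 continuous_intros)
qed

text \<open>On this set the flow is strictly positive in its second coordinate, so it contains no
  exceptional time and the equation holds throughout.\<close>

lemma heston_L_flow_ode: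
  assumes "x $ 2 > 0"
  shows "ode_solution (heston_L n) {s. real n * s + (x $ 2) powr (real n / 2) > 0}
    (\<lambda>s. heston_L_flow n s x)"
  unfolding ode_solution_def heston_L_flow_eq heston_L_eq vector_2
  using n assms by (auto intro!: has_vector_derivative_vector_2 power_flow_has_derivative
    intro: has_vector_derivative_at_within simp: pos_part_of_pos)

text \<open>The condition on \<open>x\<close> and \<open>t\<close> lists the starts from which
  uniqueness of the scalar equation was shown: positive ones in both directions of time, and zero
  backwards. The first coordinate is constant.\<close>

lemma flow_heston_L:
  assumes x: "x $ 2 > 0 \<or> x $ 2 = 0 \<and> t \<le> 0"
  shows "flow (heston_L n) t x = heston_L_flow n t x"
proof (rule flow_eqI[OF heston_L_flow_pw_ode])
  show "heston_L_flow n 0 x = x"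
    using x by (intro vec2_eqI) (auto simp: heston_L_flow_0 pos_part_of_pos)
  fix v assume v: "pw_ode_solution (heston_L n) (closed_segment 0 t) v" "v 0 = x"
  have v1: "v t $ 1 = x $ 1"
    using pw_ode_solution_zero_constant[OF pw_ode_solution_component[OF v(1)], of 1] v(2)
    by (simp add: heston_L_component)
  have v2: "pw_ode_solution (power_field (real n)) (closed_segment 0 t) (\<lambda>s. v s $ 2)"
    by (rule pw_ode_solution_component[OF v(1)]) (simp add: heston_L_eq)
  have "v t $ 2 = power_flow (real n) t (x $ 2)"
  proof (cases "t \<le> 0")
    case True
    then have "closed_segment 0 t = {t..0}" by (auto simp: closed_segment_eq_real_ivl)
    then have "pw_ode_solution (power_field (real n)) {t..0} (\<lambda>s. v s $ 2)"
      using v2 by simp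
    from power_ode_unique_backward[OF _ this True] n x show ?thesis
      unfolding v(2) by force
  next
    case False
    then have "closed_segment 0 t = {0..t}" by (simp add: closed_segment_eq_real_ivl)
    then have "pw_ode_solution (power_field (real n)) {0..t} (\<lambda>s. v s $ 2)"
      using v2 by simp
    from power_ode_unique_forward[OF _ this] n x False show ?thesis
      unfolding v(2) by force
  qed
  with v1 show "v t = heston_L_flow n t x"
    by (intro vec2_eqI) (simp_all add: heston_L_flow_eq)
qed

text \<open>Gives the closed formula a meaning for every \<open>x\<close>: the starts
  \<open>pos_part (x $ 2) + \<epsilon>\<close> are positive, so their flow is known, and the formula
  is continuous in the start and depends on \<open>x $ 2\<close> only through its positive
  part.\<close>

lemma flow_heston_L_tendsto:
  "((\<lambda>\<epsilon>. flow (heston_L n) t (vector [x $ 1, pos_part (x $ 2) + \<epsilon>])) \<longlongrightarrow> heston_L_flow n t x) (at_right 0)"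
proof -
  have "continuous_on UNIV (\<lambda>\<epsilon>. power_flow (real n) t (pos_part (x $ 2) + \<epsilon>))"
    using n by (intro continuous_on_power_flow continuous_intros) simp
  then have "((\<lambda>\<epsilon>. power_flow (real n) t (pos_part (x $ 2) + \<epsilon>)) \<longlongrightarrow>
      power_flow (real n) t (pos_part (x $ 2) + 0)) (at_right 0)"
    by (meson UNIV_I continuous_on_def tendsto_within_subset subset_UNIV)
  also have "power_flow (real n) t (pos_part (x $ 2) + 0) = power_flow (real n) t (x $ 2)"
    by (simp add: power_flow_def pos_part_of_pos pos_part_nonneg)
  finally have "((\<lambda>\<epsilon>. heston_L_flow n t (vector [x $ 1, pos_part (x $ 2) + \<epsilon>])) \<longlongrightarrow> heston_L_flow n t x) (at_right 0)"
    by (simp add: heston_L_flow_eq tendsto_vector_2)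
  moreover have "\<forall>\<^sub>F \<epsilon> in at_right 0. heston_L_flow n t (vector [x $ 1, pos_part (x $ 2) + \<epsilon>])
      = flow (heston_L n) t (vector [x $ 1, pos_part (x $ 2) + \<epsilon>])"
    using eventually_at_right_less[of "0::real"]
    by eventually_elim (simp add: flow_heston_L pos_part_nonneg add_nonneg_pos)
  ultimately show ?thesis
    by (rule Lim_transform_eventually)
qed

end

theorem mainTheorem3:
  fixes \<mu> \<kappa> \<theta> \<xi> \<rho> :: real
  assumes "\<bar>\<rho>\<bar> \<le> 1"
  shows
    "(\<forall>n m.
        bracket_on {x. x $ 2 \<noteq> 0} (heston_M n) (heston_M m) (\<lambda>x. 0) \<and>
        bracket_on {x. x $ 2 \<noteq> 0} (heston_M n) (heston_L m)
          (\<lambda>x. (real n - 2) *\<^sub>R heston_M (n + m) x) \<and>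
        bracket_on {x. x $ 2 \<noteq> 0} (heston_L n) (heston_L m)
          (\<lambda>x. (real n - real m) *\<^sub>R heston_L (n + m) x) \<and>
        bracket_on {x. x $ 2 \<noteq> 0} (heston_W n) (heston_W m)
          (\<lambda>x. heston_c n m *\<^sub>R heston_W (n + m) x))
     \<and>
     (\<forall>x. x $ 2 > 0 \<longrightarrow>
        heston_field \<mu> \<kappa> \<theta> \<xi> \<rho> 0 x =
          (1 / 2 * (\<mu> - \<xi> * \<rho> / 4)) *\<^sub>R heston_W 5 x - (1 / 4) *\<^sub>R heston_W 1 x
          + (1 / 2 * (\<kappa> * \<theta> - \<xi>\<^sup>2 / 4)) *\<^sub>R heston_W 4 x - (\<kappa> / 2) *\<^sub>R heston_W 0 x) \<and>
     (\<forall>x. heston_field \<mu> \<kappa> \<theta> \<xi> \<rho> 1 x =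
          (1 / 2) *\<^sub>R heston_W 3 x + (\<xi> * \<rho> / 2) *\<^sub>R heston_W 2 x) \<and>
     (\<forall>x. heston_field \<mu> \<kappa> \<theta> \<xi> \<rho> 2 x =
          (\<xi> * sqrt (1 - \<rho>\<^sup>2) / 2) *\<^sub>R heston_W 2 x) \<and>
     witt_condition_on {x. x $ 2 > 0} 2 (heston_field \<mu> \<kappa> \<theta> \<xi> \<rho>)
     \<and>
     (\<forall>n x.
        heston_M_flow n 0 x = x \<and>
        ode_solution (heston_M n) UNIV (\<lambda>s. heston_M_flow n s x) \<and>
        (\<forall>t. flow (heston_M n) t x = heston_M_flow n t x)) \<and>
     (\<forall>n\<ge>1. \<forall>x.
        heston_L_flow n 0 x = vector [x $ 1, pos_part (x $ 2)] \<and>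
        pw_ode_solution (heston_L n) UNIV (\<lambda>s. heston_L_flow n s x) \<and>
        (x $ 2 > 0 \<longrightarrow>
           ode_solution (heston_L n) {s. real n * s + (x $ 2) powr (real n / 2) > 0}
             (\<lambda>s. heston_L_flow n s x)) \<and>
        (\<forall>t. x $ 2 > 0 \<or> x $ 2 = 0 \<and> t \<le> 0 \<longrightarrow>
           flow (heston_L n) t x = heston_L_flow n t x) \<and>
        (\<forall>t. ((\<lambda>\<epsilon>. flow (heston_L n) t (vector [x $ 1, pos_part (x $ 2) + \<epsilon>]))
               \<longlongrightarrow> heston_L_flow n t x) (at_right 0)))"
proof (intro conjI allI impI)
  fix n m :: nat
  have U: "open {x :: real ^ 2. x $ 2 \<noteq> 0}"
    by (intro open_Collect_neq continuous_intros)
  note brackets = bracket_heston[OF U subset_refl] bracket_heston_W[OF U subset_refl]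
  show "bracket_on {x. x $ 2 \<noteq> 0} (heston_M n) (heston_M m) (\<lambda>x. 0)"
    and "bracket_on {x. x $ 2 \<noteq> 0} (heston_M n) (heston_L m)
      (\<lambda>x. (real n - 2) *\<^sub>R heston_M (n + m) x)"
    and "bracket_on {x. x $ 2 \<noteq> 0} (heston_L n) (heston_L m)
      (\<lambda>x. (real n - real m) *\<^sub>R heston_L (n + m) x)"
    and "bracket_on {x. x $ 2 \<noteq> 0} (heston_W n) (heston_W m)
      (\<lambda>x. heston_c n m *\<^sub>R heston_W (n + m) x)"
    by (rule brackets)+
qed (simp_all only: heston_field_0[OF assms] heston_field_1 heston_field_2
  witt_condition_heston[OF assms] heston_M_flow_0 heston_M_flow_ode flow_heston_M
  heston_L_flow_0 heston_L_flow_pw_ode heston_L_flow_ode flow_heston_L flow_heston_L_tendsto)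

end
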